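(* Let $X$ and $Z$ be independent real random variables and, for $\sigma>0$, let $Y=X+\sigma Z$ and $\mathcal{E}_\sigma=\frac{X-\mathbb{E}[X\mid Y]}{\sigma}$. Suppose that $X$ has a probability density function $f_X$ (with respect to Lebesgue measure) that is continuous and bounded, and that $Z\in L^1$. Then $$\lim_{\sigma\to0}\mathcal{E}_\sigma=\mathbb{E}[Z]-Z\qquad\text{a.s.}$$
   Context: $L^1$ is the set of random variables with finite first absolute moment. $\mathbb{E}[X\mid Y=y]=\int x\,\mathrm{d}P_{X|Y=y}(x)$, with $P_{X|Y=y}$ the conditional distribution. Equivalently $\mathcal{E}_\sigma=\mathbb{E}[Z\mid Y]-Z$, where the version of the conditional expectation used is $$\mathbb{E}[Z\mid Y=y]=\frac{\mathbb{E}[Z f_X(y-\sigma Z)]}{\mathbb{E}[f_X(y-\sigma Z)]}$$ (whenever the denominator is positive), for every $\sigma>0$. *)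

theory Defs
  imports "HOL-Probability.Probability"
begin

definition is_cond_distr ::
    "'a measure \<Rightarrow> ('a \<Rightarrow> real) \<Rightarrow> ('a \<Rightarrow> real) \<Rightarrow> (real \<Rightarrow> real measure) \<Rightarrow> bool" where
  "is_cond_distr M X Y \<kappa> \<longleftrightarrow>
     \<kappa> \<in> borel \<rightarrow>\<^sub>M prob_algebra borel \<and>
     (\<forall>A\<in>sets borel. \<forall>B\<in>sets borel.
        emeasure M {\<omega> \<in> space M. X \<omega> \<in> A \<and> Y \<omega> \<in> B}
          = (\<integral>\<^sup>+ \<omega>. emeasure (\<kappa> (Y \<omega>)) A * indicator B (Y \<omega>) \<partial>M))"

(* The version of P(X | Y = y), for Y = X + \<sigma> Z and X with density f, given by Bayes' rule at
   every y where the density E[f (y - \<sigma> Z)] of Y is positive. Only one version per \<sigma> can be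
   used, because the null sets of uncountably many \<sigma> cannot be discarded together. Where the
   density of Y vanishes the value is arbitrary. That this is a conditional distribution, and that
   it induces the version of E[Z | Y = y] as a quotient of expectations, is proved below. *)
definition bayes_cond_distr ::
    "'a measure \<Rightarrow> ('a \<Rightarrow> real) \<Rightarrow> (real \<Rightarrow> real) \<Rightarrow> real \<Rightarrow> real \<Rightarrow> real measure" where
  "bayes_cond_distr M Z f \<sigma> y =
     (let D = \<integral>\<omega>. f (y - \<sigma> * Z \<omega>) \<partial>M in
      if 0 < D
      then distr (density M (\<lambda>\<omega>. ennreal (f (y - \<sigma> * Z \<omega>) / D))) borel (\<lambda>\<omega>. y - \<sigma> * Z \<omega>)
      else return borel 0)"

(* Defined as an integral against the conditional distribution rather than through real_cond_exp,
   since X itself need not be integrable. *)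
definition cond_mean ::
    "'a measure \<Rightarrow> ('a \<Rightarrow> real) \<Rightarrow> (real \<Rightarrow> real) \<Rightarrow> real \<Rightarrow> real \<Rightarrow> real" where
  "cond_mean M Z f \<sigma> y = (\<integral>x. x \<partial>bayes_cond_distr M Z f \<sigma> y)"

definition scaled_error ::
    "'a measure \<Rightarrow> ('a \<Rightarrow> real) \<Rightarrow> ('a \<Rightarrow> real) \<Rightarrow> (real \<Rightarrow> real) \<Rightarrow> real \<Rightarrow> 'a \<Rightarrow> real" where
  "scaled_error M X Z f \<sigma> \<omega> =
     (let Y = X \<omega> + \<sigma> * Z \<omega> in (X \<omega> - cond_mean M Z f \<sigma> Y) / \<sigma>)"

context
  fixes M :: "'a measure" and X Z :: "'a \<Rightarrow> real" and f :: "real \<Rightarrow> real"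
  assumes M: "prob_space M"
    and indep: "prob_space.indep_var M borel X borel Z"
    and dens: "distributed M lborel X (\<lambda>x. ennreal (f x))"
    and f_nonneg: "\<And>x. 0 \<le> f x"
    and f_bdd: "bounded (range f)"
begin

interpretation prob_space M by (rule M)

lemma f_meas [measurable]: "f \<in> borel_measurable borel"
  using distributed_real_measurable[OF _ dens] f_nonneg by simp

lemma X_meas [measurable]: "X \<in> borel_measurable M"
  using indep_var_rv1[OF indep] .

lemma Z_meas [measurable]: "Z \<in> borel_measurable M"
  using indep_var_rv2[OF indep] .

lemma f_le: obtains C where "\<And>x. f x \<le> C" "0 \<le> C"
proof -
  obtain C where C: "\<And>x. \<bar>f x\<bar> \<le> C"
    using f_bdd unfolding bounded_iff by auto
  have "0 \<le> C" using C[of 0] by linarith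
  moreover have "f x \<le> C" for x using C[of x] by linarith
  ultimately show ?thesis using that by blast
qed

lemma int_f: "integrable M (\<lambda>\<omega>. f (y - \<sigma> * Z \<omega>))"
proof -
  obtain C where "\<And>x. f x \<le> C" using f_le by blast
  then show ?thesis
    by (intro integrable_const_bound[where B=C]) (auto simp: f_nonneg)
qed

lemma int_Zf: "integrable M Z \<Longrightarrow> integrable M (\<lambda>\<omega>. Z \<omega> * f (y - \<sigma> * Z \<omega>))"
proof -
  assume Z: "integrable M Z"
  obtain C where C: "\<And>x. f x \<le> C" "0 \<le> C" using f_le by blast
  show ?thesis
  proof (rule Bochner_Integration.integrable_bound)
    show "integrable M (\<lambda>\<omega>. C * Z \<omega>)" using Z by simp
    show "AE \<omega> in M. norm (Z \<omega> * f (y - \<sigma> * Z \<omega>)) \<le> norm (C * Z \<omega>)"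
      using C f_nonneg by (auto simp: abs_mult mult.commute[of C] intro!: mult_left_mono)
  qed measurable
qed

lemma cond_mean_eq:
  assumes Z: "integrable M Z" and D: "0 < (\<integral>\<omega>. f (y - \<sigma> * Z \<omega>) \<partial>M)"
  shows "cond_mean M Z f \<sigma> y
    = y - \<sigma> * ((\<integral>\<omega>. Z \<omega> * f (y - \<sigma> * Z \<omega>) \<partial>M) / (\<integral>\<omega>. f (y - \<sigma> * Z \<omega>) \<partial>M))"
proof -
  let ?D = "\<integral>\<omega>. f (y - \<sigma> * Z \<omega>) \<partial>M"
  let ?N = "\<integral>\<omega>. Z \<omega> * f (y - \<sigma> * Z \<omega>) \<partial>M"
  have "cond_mean M Z f \<sigma> y = (\<integral>\<omega>. f (y - \<sigma> * Z \<omega>) / ?D * (y - \<sigma> * Z \<omega>) \<partial>M)"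
    using D f_nonneg
    by (simp add: cond_mean_def bayes_cond_distr_def Let_def integral_distr integral_density)
  also have "\<dots> = (\<integral>\<omega>. (y * f (y - \<sigma> * Z \<omega>) - \<sigma> * (Z \<omega> * f (y - \<sigma> * Z \<omega>))) / ?D \<partial>M)"
    by (intro Bochner_Integration.integral_cong) (auto simp: algebra_simps)
  also have "\<dots> = (y * ?D - \<sigma> * ?N) / ?D"
    using int_f int_Zf[OF Z] by simp
  finally show ?thesis using D by (simp add: field_simps)
qed

lemma joint:
  "distr M (borel \<Otimes>\<^sub>M borel) (\<lambda>\<omega>. (X \<omega> + \<sigma> * Z \<omega>, Z \<omega>))
     = density (lborel \<Otimes>\<^sub>M distr M borel Z) (\<lambda>(y, z). ennreal (f (y - \<sigma> * z)))"
proof -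
  let ?Q = "distr M borel Z"
  interpret Q: prob_space ?Q by (rule prob_space_distr) simp
  interpret LQ: pair_sigma_finite lborel ?Q ..
  interpret DQ: pair_sigma_finite "distr M borel X" ?Q
    by (simp add: pair_sigma_finite_def Q.sigma_finite_measure prob_space_distr
        prob_space_imp_sigma_finite)
  have XZ: "distr M borel X \<Otimes>\<^sub>M ?Q = distr M (borel \<Otimes>\<^sub>M borel) (\<lambda>\<omega>. (X \<omega>, Z \<omega>))"
    using indep unfolding indep_var_distribution_eq by simp
  have PX: "distr M borel X = density lborel (\<lambda>x. ennreal (f x))"
    using dens by (simp add: distributed_def cong: distr_cong)
  show ?thesis
  proof (rule measure_eqI)
    fix A :: "(real \<times> real) set"
    assume "A \<in> sets (distr M (borel \<Otimes>\<^sub>M borel) (\<lambda>\<omega>. (X \<omega> + \<sigma> * Z \<omega>, Z \<omega>)))"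
    then have A[measurable]: "A \<in> sets (borel \<Otimes>\<^sub>M borel)" by simp
    have "emeasure (distr M (borel \<Otimes>\<^sub>M borel) (\<lambda>\<omega>. (X \<omega> + \<sigma> * Z \<omega>, Z \<omega>))) A
        = (\<integral>\<^sup>+\<omega>. indicator A (X \<omega> + \<sigma> * Z \<omega>, Z \<omega>) \<partial>M)"
      by (subst nn_integral_indicator[symmetric], simp, subst nn_integral_distr) auto
    also have "\<dots> = (\<integral>\<^sup>+p. indicator A (fst p + \<sigma> * snd p, snd p)
                       \<partial>distr M (borel \<Otimes>\<^sub>M borel) (\<lambda>\<omega>. (X \<omega>, Z \<omega>)))"
      by (subst nn_integral_distr) auto
    also have "\<dots> = (\<integral>\<^sup>+p. indicator A (fst p + \<sigma> * snd p, snd p) \<partial>(distr M borel X \<Otimes>\<^sub>M ?Q))"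
      by (simp only: XZ)
    also have "\<dots> = (\<integral>\<^sup>+z. \<integral>\<^sup>+x. indicator A (x + \<sigma> * z, z) \<partial>distr M borel X \<partial>?Q)"
      by (subst DQ.nn_integral_snd[symmetric]) auto
    also have "\<dots> = (\<integral>\<^sup>+z. \<integral>\<^sup>+x. ennreal (f x) * indicator A (x + \<sigma> * z, z) \<partial>lborel \<partial>?Q)"
      unfolding PX by (intro nn_integral_cong, subst nn_integral_density) auto
    also have "\<dots> = (\<integral>\<^sup>+z. \<integral>\<^sup>+y. ennreal (f (y - \<sigma> * z)) * indicator A (y, z) \<partial>lborel \<partial>?Q)"
    proof (rule nn_integral_cong)
      fix z
      show "(\<integral>\<^sup>+x. ennreal (f x) * indicator A (x + \<sigma> * z, z) \<partial>lborel)
          = (\<integral>\<^sup>+y. ennreal (f (y - \<sigma> * z)) * indicator A (y, z) \<partial>lborel)"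
        by (subst nn_integral_real_affine[where c=1 and t="- (\<sigma> * z)"]) auto
    qed
    also have "\<dots> = (\<integral>\<^sup>+p. ennreal (f (fst p - \<sigma> * snd p)) * indicator A p \<partial>(lborel \<Otimes>\<^sub>M ?Q))"
      by (subst LQ.nn_integral_snd[symmetric]) auto
    also have "\<dots> = emeasure (density (lborel \<Otimes>\<^sub>M ?Q) (\<lambda>(y, z). ennreal (f (y - \<sigma> * z)))) A"
      by (subst emeasure_density) (auto simp: case_prod_beta)
    finally show "emeasure (distr M (borel \<Otimes>\<^sub>M borel) (\<lambda>\<omega>. (X \<omega> + \<sigma> * Z \<omega>, Z \<omega>))) A
      = emeasure (density (lborel \<Otimes>\<^sub>M ?Q) (\<lambda>(y, z). ennreal (f (y - \<sigma> * z)))) A" .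
  qed simp
qed

lemma nn_joint:
  assumes [measurable]: "case_prod h \<in> borel_measurable (borel \<Otimes>\<^sub>M borel)"
  shows "(\<integral>\<^sup>+\<omega>. h (X \<omega> + \<sigma> * Z \<omega>) (Z \<omega>) \<partial>M)
    = (\<integral>\<^sup>+y. \<integral>\<^sup>+\<omega>. ennreal (f (y - \<sigma> * Z \<omega>)) * h y (Z \<omega>) \<partial>M \<partial>lborel)"
proof -
  let ?Q = "distr M borel Z"
  interpret Q: prob_space ?Q by (rule prob_space_distr) simp
  have "(\<integral>\<^sup>+\<omega>. h (X \<omega> + \<sigma> * Z \<omega>) (Z \<omega>) \<partial>M)
      = (\<integral>\<^sup>+p. case_prod h p
           \<partial>distr M (borel \<Otimes>\<^sub>M borel) (\<lambda>\<omega>. (X \<omega> + \<sigma> * Z \<omega>, Z \<omega>)))"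
    by (subst nn_integral_distr) auto
  also have "\<dots> = (\<integral>\<^sup>+p. ennreal (f (fst p - \<sigma> * snd p)) * case_prod h p \<partial>(lborel \<Otimes>\<^sub>M ?Q))"
    unfolding joint by (subst nn_integral_density) (auto simp: case_prod_beta)
  also have "\<dots> = (\<integral>\<^sup>+y. \<integral>\<^sup>+z. ennreal (f (y - \<sigma> * z)) * h y z \<partial>?Q \<partial>lborel)"
    by (subst Q.nn_integral_fst[symmetric]) auto
  also have "\<dots> = (\<integral>\<^sup>+y. \<integral>\<^sup>+\<omega>. ennreal (f (y - \<sigma> * Z \<omega>)) * h y (Z \<omega>) \<partial>M \<partial>lborel)"
    by (intro nn_integral_cong, subst nn_integral_distr) auto
  finally show ?thesis .
qed

lemma int_joint:
  fixes h :: "real \<Rightarrow> real \<Rightarrow> real"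
  assumes [measurable]: "case_prod h \<in> borel_measurable (borel \<Otimes>\<^sub>M borel)"
    and int: "integrable M (\<lambda>\<omega>. h (X \<omega> + \<sigma> * Z \<omega>) (Z \<omega>))"
  shows "(\<integral>\<omega>. h (X \<omega> + \<sigma> * Z \<omega>) (Z \<omega>) \<partial>M)
    = (\<integral>y. \<integral>\<omega>. f (y - \<sigma> * Z \<omega>) * h y (Z \<omega>) \<partial>M \<partial>lborel)"
proof -
  let ?Q = "distr M borel Z"
  let ?J = "distr M (borel \<Otimes>\<^sub>M borel) (\<lambda>\<omega>. (X \<omega> + \<sigma> * Z \<omega>, Z \<omega>))"
  interpret Q: prob_space ?Q by (rule prob_space_distr) simp
  interpret LQ: pair_sigma_finite lborel ?Q ..
  have J: "?J = density (lborel \<Otimes>\<^sub>M ?Q) (\<lambda>p. ennreal (f (fst p - \<sigma> * snd p)))"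
    unfolding joint by (simp add: case_prod_unfold)
  have "integrable ?J (case_prod h)"
    by (subst integrable_distr_eq) (auto simp: int)
  then have i: "integrable (lborel \<Otimes>\<^sub>M ?Q) (\<lambda>p. f (fst p - \<sigma> * snd p) * case_prod h p)"
    unfolding J by (subst (asm) integrable_density) (auto simp: f_nonneg)
  have "(\<integral>\<omega>. h (X \<omega> + \<sigma> * Z \<omega>) (Z \<omega>) \<partial>M) = (\<integral>p. case_prod h p \<partial>?J)"
    by (subst integral_distr) auto
  also have "\<dots> = (\<integral>p. f (fst p - \<sigma> * snd p) * case_prod h p \<partial>(lborel \<Otimes>\<^sub>M ?Q))"
    unfolding J by (subst integral_density) (auto simp: f_nonneg)
  also have "\<dots> = (\<integral>y. \<integral>z. f (y - \<sigma> * z) * h y z \<partial>?Q \<partial>lborel)"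
    using LQ.integral_fst'[OF i] by simp
  also have "\<dots> = (\<integral>y. \<integral>\<omega>. f (y - \<sigma> * Z \<omega>) * h y (Z \<omega>) \<partial>M \<partial>lborel)"
    by (intro Bochner_Integration.integral_cong refl, subst integral_distr) auto
  finally show ?thesis .
qed

lemma nn_f_eq: "(\<integral>\<^sup>+\<omega>. ennreal (f (y - \<sigma> * Z \<omega>)) \<partial>M) = ennreal (\<integral>\<omega>. f (y - \<sigma> * Z \<omega>) \<partial>M)"
  by (intro nn_integral_eq_integral int_f) (auto simp: f_nonneg)

lemma AE_f_eq_0:
  assumes "\<not> 0 < (\<integral>\<omega>. f (y - \<sigma> * Z \<omega>) \<partial>M)"
  shows "AE \<omega> in M. f (y - \<sigma> * Z \<omega>) = 0"
proof -
  have "0 \<le> (\<integral>\<omega>. f (y - \<sigma> * Z \<omega>) \<partial>M)" by (simp add: f_nonneg)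
  then have "(\<integral>\<omega>. f (y - \<sigma> * Z \<omega>) \<partial>M) = 0" using assms by linarith
  then show ?thesis
    using integral_nonneg_eq_0_iff_AE[OF int_f] f_nonneg by simp
qed

lemma emeasure_bayes:
  assumes [measurable]: "A \<in> sets borel"
  shows "emeasure (bayes_cond_distr M Z f \<sigma> y) A =
    (if 0 < (\<integral>\<omega>. f (y - \<sigma> * Z \<omega>) \<partial>M)
     then (\<integral>\<^sup>+\<omega>. ennreal (f (y - \<sigma> * Z \<omega>)) * indicator A (y - \<sigma> * Z \<omega>) \<partial>M)
       / ennreal (\<integral>\<omega>. f (y - \<sigma> * Z \<omega>) \<partial>M)
     else indicator A 0)"
proof (cases "0 < (\<integral>\<omega>. f (y - \<sigma> * Z \<omega>) \<partial>M)")
  case True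
  let ?D = "\<integral>\<omega>. f (y - \<sigma> * Z \<omega>) \<partial>M"
  have "emeasure (bayes_cond_distr M Z f \<sigma> y) A
     = (\<integral>\<^sup>+x. indicator A x \<partial>bayes_cond_distr M Z f \<sigma> y)"
    using True by (subst nn_integral_indicator) (auto simp: bayes_cond_distr_def Let_def)
  also have "\<dots> = (\<integral>\<^sup>+\<omega>. ennreal (f (y - \<sigma> * Z \<omega>) / ?D) * indicator A (y - \<sigma> * Z \<omega>) \<partial>M)"
    using True
    by (simp add: bayes_cond_distr_def Let_def nn_integral_distr nn_integral_density
        del: nn_integral_indicator)
  also have "\<dots> = (\<integral>\<^sup>+\<omega>. ennreal (f (y - \<sigma> * Z \<omega>)) * indicator A (y - \<sigma> * Z \<omega>) / ennreal ?D \<partial>M)"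
    using True f_nonneg
    by (intro nn_integral_cong) (auto simp: divide_ennreal[symmetric] indicator_def)
  also have "\<dots> = (\<integral>\<^sup>+\<omega>. ennreal (f (y - \<sigma> * Z \<omega>)) * indicator A (y - \<sigma> * Z \<omega>) \<partial>M) / ennreal ?D"
    by (rule nn_integral_divide) simp
  finally show ?thesis using True by simp
qed (simp add: bayes_cond_distr_def Let_def)

lemma sets_bayes [simp]: "sets (bayes_cond_distr M Z f \<sigma> y) = sets borel"
  by (simp add: bayes_cond_distr_def Let_def)

lemma prob_space_bayes: "prob_space (bayes_cond_distr M Z f \<sigma> y)"
proof
  have "space (bayes_cond_distr M Z f \<sigma> y) = UNIV"
    by (simp add: bayes_cond_distr_def Let_def)
  then show "emeasure (bayes_cond_distr M Z f \<sigma> y) (space (bayes_cond_distr M Z f \<sigma> y)) = 1"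
    by (subst emeasure_bayes)
       (auto simp: nn_f_eq ennreal_divide_self)
qed

lemma bayes_measurable: "bayes_cond_distr M Z f \<sigma> \<in> borel \<rightarrow>\<^sub>M prob_algebra borel"
proof (rule measurable_prob_algebraI)
  show "bayes_cond_distr M Z f \<sigma> \<in> borel \<rightarrow>\<^sub>M subprob_algebra borel"
  proof (rule measurable_subprob_algebra)
    fix A :: "real set" assume [measurable]: "A \<in> sets borel"
    show "(\<lambda>y. emeasure (bayes_cond_distr M Z f \<sigma> y) A) \<in> borel_measurable borel"
      by (subst emeasure_bayes) measurable
  qed (auto simp: prob_space_bayes prob_space_imp_subprob_space)
qed (rule prob_space_bayes)

lemma is_cond_distr_bayes:
  "is_cond_distr M X (\<lambda>\<omega>. X \<omega> + \<sigma> * Z \<omega>) (bayes_cond_distr M Z f \<sigma>)"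
  unfolding is_cond_distr_def
proof (intro conjI ballI)
  show "bayes_cond_distr M Z f \<sigma> \<in> borel \<rightarrow>\<^sub>M prob_algebra borel" by (rule bayes_measurable)
next
  fix A B :: "real set" assume [measurable]: "A \<in> sets borel" "B \<in> sets borel"
  have [measurable]: "(\<lambda>y. emeasure (bayes_cond_distr M Z f \<sigma> y) A) \<in> borel_measurable borel"
    by (subst emeasure_bayes) measurable
  have "emeasure M {\<omega> \<in> space M. X \<omega> \<in> A \<and> X \<omega> + \<sigma> * Z \<omega> \<in> B}
      = (\<integral>\<^sup>+\<omega>. indicator A ((X \<omega> + \<sigma> * Z \<omega>) - \<sigma> * Z \<omega>) * indicator B (X \<omega> + \<sigma> * Z \<omega>) \<partial>M)"
  proof (subst nn_integral_indicator[symmetric])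
    show "(\<integral>\<^sup>+\<omega>. indicator {\<omega> \<in> space M. X \<omega> \<in> A \<and> X \<omega> + \<sigma> * Z \<omega> \<in> B} \<omega> \<partial>M)
      = (\<integral>\<^sup>+\<omega>. indicator A ((X \<omega> + \<sigma> * Z \<omega>) - \<sigma> * Z \<omega>) * indicator B (X \<omega> + \<sigma> * Z \<omega>) \<partial>M)"
      by (rule nn_integral_cong) (auto simp: indicator_def)
  qed measurable
  also have "\<dots> = (\<integral>\<^sup>+y. \<integral>\<^sup>+\<omega>. ennreal (f (y - \<sigma> * Z \<omega>))
                  * (indicator A (y - \<sigma> * Z \<omega>) * indicator B y) \<partial>M \<partial>lborel)"
    by (rule nn_joint[where h="\<lambda>y z. indicator A (y - \<sigma> * z) * indicator B y"]) measurable
  also have "\<dots> = (\<integral>\<^sup>+y. \<integral>\<^sup>+\<omega>. ennreal (f (y - \<sigma> * Z \<omega>))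
      * (emeasure (bayes_cond_distr M Z f \<sigma> y) A * indicator B y) \<partial>M \<partial>lborel)"
  proof (rule nn_integral_cong)
    fix y
    let ?N = "\<integral>\<^sup>+\<omega>. ennreal (f (y - \<sigma> * Z \<omega>)) * indicator A (y - \<sigma> * Z \<omega>) \<partial>M"
    let ?D = "\<integral>\<omega>. f (y - \<sigma> * Z \<omega>) \<partial>M"
    have eq: "?N = ennreal ?D * emeasure (bayes_cond_distr M Z f \<sigma> y) A"
    proof (cases "0 < ?D")
      case True
      then show ?thesis
        by (simp add: emeasure_bayes ennreal_times_divide mult.commute[of "ennreal ?D"]
            mult_divide_eq_ennreal)
    next
      case False
      have "?N = (\<integral>\<^sup>+\<omega>. 0 \<partial>M)"
        by (rule nn_integral_cong_AE) (use AE_f_eq_0[OF False] in auto)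
      moreover have "ennreal ?D = 0" using False by (simp add: ennreal_eq_0_iff)
      ultimately show ?thesis by simp
    qed
    have "(\<integral>\<^sup>+\<omega>. ennreal (f (y - \<sigma> * Z \<omega>)) * (indicator A (y - \<sigma> * Z \<omega>) * indicator B y) \<partial>M)
        = ?N * indicator B y"
      by (subst nn_integral_multc[symmetric]) (auto simp: mult.assoc)
    also have "\<dots> = ennreal ?D * (emeasure (bayes_cond_distr M Z f \<sigma> y) A * indicator B y)"
      by (simp add: eq mult.assoc)
    also have "\<dots> = (\<integral>\<^sup>+\<omega>. ennreal (f (y - \<sigma> * Z \<omega>))
        * (emeasure (bayes_cond_distr M Z f \<sigma> y) A * indicator B y) \<partial>M)"
      by (subst nn_integral_multc) (auto simp: nn_f_eq)
    finally show "(\<integral>\<^sup>+\<omega>. ennreal (f (y - \<sigma> * Z \<omega>))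
          * (indicator A (y - \<sigma> * Z \<omega>) * indicator B y) \<partial>M)
      = (\<integral>\<^sup>+\<omega>. ennreal (f (y - \<sigma> * Z \<omega>))
        * (emeasure (bayes_cond_distr M Z f \<sigma> y) A * indicator B y) \<partial>M)" .
  qed
  also have "\<dots> = (\<integral>\<^sup>+\<omega>. emeasure (bayes_cond_distr M Z f \<sigma> (X \<omega> + \<sigma> * Z \<omega>)) A
                  * indicator B (X \<omega> + \<sigma> * Z \<omega>) \<partial>M)"
    by (rule nn_joint[symmetric,
          where h="\<lambda>y z. emeasure (bayes_cond_distr M Z f \<sigma> y) A * indicator B y"]) measurable
  finally show "emeasure M {\<omega> \<in> space M. X \<omega> \<in> A \<and> X \<omega> + \<sigma> * Z \<omega> \<in> B}
      = (\<integral>\<^sup>+\<omega>. emeasure (bayes_cond_distr M Z f \<sigma> (X \<omega> + \<sigma> * Z \<omega>)) A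
                  * indicator B (X \<omega> + \<sigma> * Z \<omega>) \<partial>M)" .
qed

lemma AE_D_pos: "AE \<omega> in M. 0 < (\<integral>\<omega>'. f (X \<omega> + \<sigma> * Z \<omega> - \<sigma> * Z \<omega>') \<partial>M)"
proof -
  let ?D = "\<lambda>y. \<integral>\<omega>'. f (y - \<sigma> * Z \<omega>') \<partial>M"
  define S where "S = {y. \<not> 0 < ?D y}"
  have [measurable]: "S \<in> sets borel" unfolding S_def by measurable
  have "(\<integral>\<^sup>+\<omega>. indicator S (X \<omega> + \<sigma> * Z \<omega>) \<partial>M)
     = (\<integral>\<^sup>+y. \<integral>\<^sup>+\<omega>. ennreal (f (y - \<sigma> * Z \<omega>)) * indicator S y \<partial>M \<partial>lborel)"
    by (rule nn_joint[where h="\<lambda>y z. indicator S y"]) measurable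
  also have "\<dots> = (\<integral>\<^sup>+y. 0 \<partial>(lborel :: real measure))"
  proof (rule nn_integral_cong)
    fix y
    show "(\<integral>\<^sup>+\<omega>. ennreal (f (y - \<sigma> * Z \<omega>)) * indicator S y \<partial>M) = 0"
      by (subst nn_integral_multc) (auto simp: nn_f_eq ennreal_eq_0_iff indicator_def S_def)
  qed
  finally have "AE \<omega> in M. indicator S (X \<omega> + \<sigma> * Z \<omega>) = (0::ennreal)"
    by (intro nn_integral_0_iff_AE[THEN iffD1]) (simp_all del: nn_integral_indicator)
  then show ?thesis by eventually_elim (auto simp: S_def indicator_def split: if_splits)
qed

lemma real_cond_exp_noise:
  assumes Z: "integrable M Z"
  shows "AE \<omega> in M.
    real_cond_exp M (vimage_algebra (space M) (\<lambda>\<omega>. X \<omega> + \<sigma> * Z \<omega>) borel) Z \<omega>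
      = (\<integral>\<omega>'. Z \<omega>' * f (X \<omega> + \<sigma> * Z \<omega> - \<sigma> * Z \<omega>') \<partial>M)
          / (\<integral>\<omega>'. f (X \<omega> + \<sigma> * Z \<omega> - \<sigma> * Z \<omega>') \<partial>M)"
proof -
  let ?Y = "\<lambda>\<omega>. X \<omega> + \<sigma> * Z \<omega>"
  let ?F = "vimage_algebra (space M) ?Y borel"
  let ?N = "\<lambda>y. \<integral>\<omega>'. Z \<omega>' * f (y - \<sigma> * Z \<omega>') \<partial>M"
  let ?D = "\<lambda>y. \<integral>\<omega>'. f (y - \<sigma> * Z \<omega>') \<partial>M"
  define g where "g y = ?N y / ?D y" for y
  have [measurable]: "g \<in> borel_measurable borel" unfolding g_def by measurable
  have gD: "?D y * g y = ?N y" for y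
  proof (cases "0 < ?D y")
    case False
    have "?N y = (\<integral>\<omega>. 0 \<partial>M)"
      by (rule integral_cong_AE) (use AE_f_eq_0[OF False] in auto)
    moreover have "?D y = (\<integral>\<omega>. 0 \<partial>M)"
      by (rule integral_cong_AE) (use AE_f_eq_0[OF False] in auto)
    ultimately show ?thesis by simp
  qed (simp add: g_def)
  have D0: "0 \<le> ?D y" for y by (simp add: f_nonneg)
  have sub: "subalgebra M ?F"
    by (auto simp: subalgebra_def sets_vimage_algebra2 intro!: measurable_sets)
  interpret finite_measure_subalgebra M ?F
    by unfold_locales (rule sub)
  have "integrable M (\<lambda>\<omega>. g (?Y \<omega>))"
  proof (rule integrableI_bounded)
    have "(\<integral>\<^sup>+\<omega>. ennreal (norm (g (?Y \<omega>))) \<partial>M)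
      = (\<integral>\<^sup>+y. \<integral>\<^sup>+\<omega>. ennreal (f (y - \<sigma> * Z \<omega>)) * ennreal (norm (g y)) \<partial>M \<partial>lborel)"
      by (rule nn_joint[where h="\<lambda>y z. ennreal (norm (g y))"]) measurable
    also have "\<dots> \<le> (\<integral>\<^sup>+y. \<integral>\<^sup>+\<omega>. ennreal (f (y - \<sigma> * Z \<omega>)) * ennreal (norm (Z \<omega>)) \<partial>M \<partial>lborel)"
    proof (rule nn_integral_mono)
      fix y
      have "(\<integral>\<^sup>+\<omega>. ennreal (f (y - \<sigma> * Z \<omega>)) * ennreal (norm (g y)) \<partial>M)
          = ennreal (?D y) * ennreal (norm (g y))"
        by (subst nn_integral_multc) (auto simp: nn_f_eq)
      also have "\<dots> = ennreal (norm (?D y * g y))"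
        using D0[of y] by (simp add: ennreal_mult[symmetric] abs_mult)
      also have "\<dots> = ennreal (norm (?N y))" by (simp only: gD)
      also have "\<dots> \<le> (\<integral>\<^sup>+\<omega>. ennreal (norm (Z \<omega> * f (y - \<sigma> * Z \<omega>))) \<partial>M)"
        by (rule integral_norm_bound_ennreal[OF int_Zf[OF Z]])
      also have "\<dots> = (\<integral>\<^sup>+\<omega>. ennreal (f (y - \<sigma> * Z \<omega>)) * ennreal (norm (Z \<omega>)) \<partial>M)"
        by (intro nn_integral_cong)
           (auto simp: abs_mult f_nonneg ennreal_mult[symmetric] mult.commute)
      finally show "(\<integral>\<^sup>+\<omega>. ennreal (f (y - \<sigma> * Z \<omega>)) * ennreal (norm (g y)) \<partial>M)
        \<le> (\<integral>\<^sup>+\<omega>. ennreal (f (y - \<sigma> * Z \<omega>)) * ennreal (norm (Z \<omega>)) \<partial>M)" .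
    qed
    also have "\<dots> = (\<integral>\<^sup>+\<omega>. ennreal (norm (Z \<omega>)) \<partial>M)"
      by (rule nn_joint[symmetric, where h="\<lambda>y z. ennreal (norm z)"]) measurable
    also have "\<dots> < \<infinity>" using Z by (simp add: integrable_iff_bounded)
    finally show "(\<integral>\<^sup>+\<omega>. ennreal (norm (g (?Y \<omega>))) \<partial>M) < \<infinity>" .
  qed measurable
  note ig = this
  have "AE \<omega> in M. real_cond_exp M ?F Z \<omega> = g (?Y \<omega>)"
  proof (rule real_cond_exp_charact)
    fix A assume "A \<in> sets ?F"
    then obtain B where B[measurable]: "B \<in> sets borel" and A: "A = ?Y -` B \<inter> space M"
      by (auto simp: sets_vimage_algebra2)
    have [measurable]: "A \<in> sets M" unfolding A by measurable
    have ind: "indicator A \<omega> = (indicator B (?Y \<omega>) :: real)" if "\<omega> \<in> space M" for \<omega>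
      using that by (auto simp: A indicator_def)
    have i1: "integrable M (\<lambda>\<omega>. indicator B (?Y \<omega>) * Z \<omega>)"
      by (rule Bochner_Integration.integrable_bound[OF Z]) (auto simp: indicator_def)
    have i2: "integrable M (\<lambda>\<omega>. indicator B (?Y \<omega>) * g (?Y \<omega>))"
      by (rule Bochner_Integration.integrable_bound[OF ig]) (auto simp: indicator_def)
    have "(\<integral>\<omega>\<in>A. Z \<omega> \<partial>M) = (\<integral>\<omega>. indicator B (?Y \<omega>) * Z \<omega> \<partial>M)"
      unfolding set_lebesgue_integral_def
      by (intro Bochner_Integration.integral_cong) (auto simp: ind)
    also have "\<dots> = (\<integral>y. \<integral>\<omega>. f (y - \<sigma> * Z \<omega>) * (indicator B y * Z \<omega>) \<partial>M \<partial>lborel)"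
      by (rule int_joint[where h="\<lambda>y z. indicator B y * z", OF _ i1]) measurable
    also have "\<dots> = (\<integral>y. indicator B y * ?N y \<partial>lborel)"
    proof (rule Bochner_Integration.integral_cong)
      fix y
      have "f (y - \<sigma> * Z \<omega>) * (indicator B y * Z \<omega>)
          = indicator B y * (Z \<omega> * f (y - \<sigma> * Z \<omega>))" for \<omega>
        by simp
      then show "(\<integral>\<omega>. f (y - \<sigma> * Z \<omega>) * (indicator B y * Z \<omega>) \<partial>M) = indicator B y * ?N y"
        by (simp only: integral_mult_right_zero)
    qed simp
    also have "\<dots> = (\<integral>y. indicator B y * (?D y * g y) \<partial>lborel)" by (simp only: gD)
    also have "\<dots> = (\<integral>y. \<integral>\<omega>. f (y - \<sigma> * Z \<omega>) * (indicator B y * g y) \<partial>M \<partial>lborel)"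
      by (intro Bochner_Integration.integral_cong refl) (simp add: mult_ac)
    also have "\<dots> = (\<integral>\<omega>. indicator B (?Y \<omega>) * g (?Y \<omega>) \<partial>M)"
      by (rule int_joint[where h="\<lambda>y z. indicator B y * g y", OF _ i2, symmetric]) measurable
    also have "\<dots> = (\<integral>\<omega>\<in>A. g (?Y \<omega>) \<partial>M)"
      unfolding set_lebesgue_integral_def
      by (intro Bochner_Integration.integral_cong) (auto simp: ind)
    finally show "(\<integral>\<omega>\<in>A. Z \<omega> \<partial>M) = (\<integral>\<omega>\<in>A. g (?Y \<omega>) \<partial>M)" .
  next
    have "?Y \<in> measurable ?F borel" by (rule measurable_vimage_algebra1) auto
    then show "(\<lambda>\<omega>. g (?Y \<omega>)) \<in> borel_measurable ?F" by (rule measurable_compose) simp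
  qed (use Z ig in auto)
  then show ?thesis by (simp add: g_def)
qed

lemma scaled_error_eq:
  assumes Z: "integrable M Z" and "0 < \<sigma>"
  shows "AE \<omega> in M. scaled_error M X Z f \<sigma> \<omega>
    = real_cond_exp M (vimage_algebra (space M) (\<lambda>\<omega>. X \<omega> + \<sigma> * Z \<omega>) borel) Z \<omega> - Z \<omega>"
  using real_cond_exp_noise[OF Z, of \<sigma>] AE_D_pos[of \<sigma>]
proof eventually_elim
  case (elim \<omega>)
  then show ?case
    using \<open>0 < \<sigma>\<close> by (simp add: scaled_error_def Let_def cond_mean_eq[OF Z] field_simps)
qed

end

(* Outside the context these would apply, with unprovable premises, to every measurability goal. *)
declare f_meas [measurable del] X_meas [measurable del] Z_meas [measurable del]

end

theory Submission
  imports Defs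
begin

text \<open>
  Bayes' rule gives \<open>E[Z | Y = y] = E[Z f(y - \<sigma>Z)] / E[f(y - \<sigma>Z)]\<close>. At \<open>y = X \<omega> + \<sigma> Z \<omega>\<close> the
  argument of \<open>f\<close> tends to \<open>X \<omega>\<close>, so dominated convergence sends numerator and denominator to
  \<open>f (X \<omega>) E[Z]\<close> and \<open>f (X \<omega>)\<close>, and almost surely \<open>f (X \<omega>) > 0\<close>.
\<close>

text \<open>Stated for a general weight \<open>g\<close> so that \<open>g = Z\<close> covers the
  numerator and \<open>g = 1\<close> the denominator. Here \<open>x\<close> and \<open>z\<close> are
  the values of \<open>X\<close> and \<open>Z\<close> at one fixed outcome, while
  \<open>Z \<omega>\<close> is averaged.\<close>

lemma tendsto_integral_mult_bounded_continuous:
  fixes f :: "real \<Rightarrow> real" and g Z :: "'a \<Rightarrow> real"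
  assumes cont: "continuous_on UNIV f" and bdd: "bounded (range f)"
    and Z[measurable]: "Z \<in> borel_measurable M" and g: "integrable M g"
  shows "((\<lambda>\<sigma>. \<integral>\<omega>. g \<omega> * f (x + \<sigma> * z - \<sigma> * Z \<omega>) \<partial>M) \<longlongrightarrow> (\<integral>\<omega>. g \<omega> \<partial>M) * f x) (at_right 0)"
proof (unfold tendsto_at_iff_sequentially, safe)
  \<comment> \<open>Dominated convergence is applied along sequences; a bound \<open>C\<close> of
    \<open>f\<close> yields the integrable majorant
    \<open>C * \<bar>g \<omega>\<bar>\<close>.\<close>
  fix s :: "nat \<Rightarrow> real"
  assume s: "s \<longlonglongrightarrow> 0"
  obtain C where C: "\<And>x. \<bar>f x\<bar> \<le> C"
    using bdd unfolding bounded_iff by auto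
  have [measurable]: "f \<in> borel_measurable borel"
    using cont by (rule borel_measurable_continuous_onI)
  have [measurable]: "g \<in> borel_measurable M"
    using g by simp
  have "(\<lambda>n. \<integral>\<omega>. g \<omega> * f (x + s n * z - s n * Z \<omega>) \<partial>M) \<longlonglongrightarrow> (\<integral>\<omega>. g \<omega> * f x \<partial>M)"
  proof (rule integral_dominated_convergence[where w = "\<lambda>\<omega>. C * \<bar>g \<omega>\<bar>"])
    show "AE \<omega> in M. (\<lambda>n. g \<omega> * f (x + s n * z - s n * Z \<omega>)) \<longlonglongrightarrow> g \<omega> * f x"
    proof (rule AE_I2)
      fix \<omega>
      have "(\<lambda>n. x + s n * z - s n * Z \<omega>) \<longlonglongrightarrow> x + 0 * z - 0 * Z \<omega>"
        by (intro tendsto_intros s)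
      then have "(\<lambda>n. f (x + s n * z - s n * Z \<omega>)) \<longlonglongrightarrow> f x"
        using continuous_on_tendsto_compose[OF cont, of _ x] by simp
      then show "(\<lambda>n. g \<omega> * f (x + s n * z - s n * Z \<omega>)) \<longlonglongrightarrow> g \<omega> * f x"
        by (intro tendsto_intros)
    qed
    show "AE \<omega> in M. norm (g \<omega> * f (x + s n * z - s n * Z \<omega>)) \<le> C * \<bar>g \<omega>\<bar>" for n
      using C by (auto simp: abs_mult mult.commute[of C] intro!: mult_left_mono)
  qed (use g in auto)
  then show "((\<lambda>\<sigma>. \<integral>\<omega>. g \<omega> * f (x + \<sigma> * z - \<sigma> * Z \<omega>) \<partial>M) \<circ> s) \<longlonglongrightarrow> (\<integral>\<omega>. g \<omega> \<partial>M) * f x"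
    by (simp add: o_def)
qed

theorem theorem2:
  fixes M :: "'a measure" and X Z :: "'a \<Rightarrow> real" and f :: "real \<Rightarrow> real"
  assumes "prob_space M"
    and "prob_space.indep_var M borel X borel Z"
    and "distributed M lborel X (\<lambda>x. ennreal (f x))"
    and "\<And>x. 0 \<le> f x"
    and "continuous_on UNIV f"
    and "bounded (range f)"
    and "integrable M Z"
  shows "AE \<omega> in M.
    ((\<lambda>\<sigma>. scaled_error M X Z f \<sigma> \<omega>) \<longlongrightarrow> (\<integral>\<omega>'. Z \<omega>' \<partial>M) - Z \<omega>) (at_right 0)"
proof -
  interpret prob_space M by fact
  note ctxt = assms(1-4,6)
  have "AE \<omega> in M. 0 < f (X \<omega>)"
    \<comment> \<open>For \<open>\<sigma> = 0\<close> the noisy observation \<open>Y\<close> is \<open>X\<close> itself, with density \<open>f\<close>.\<close>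
    using AE_D_pos[OF ctxt, of 0] by (simp add: prob_space)
  \<comment> \<open>The exceptional null set does not depend on \<open>\<sigma>\<close>, so the
    limit can be taken outcome by outcome.\<close>
  then show ?thesis
  proof eventually_elim
    case (elim \<omega>)
    let ?N = "\<lambda>\<sigma>. \<integral>\<omega>'. Z \<omega>' * f (X \<omega> + \<sigma> * Z \<omega> - \<sigma> * Z \<omega>') \<partial>M"
    let ?D = "\<lambda>\<sigma>. \<integral>\<omega>'. f (X \<omega> + \<sigma> * Z \<omega> - \<sigma> * Z \<omega>') \<partial>M"
    have N: "(?N \<longlongrightarrow> (\<integral>\<omega>'. Z \<omega>' \<partial>M) * f (X \<omega>)) (at_right 0)"
      using assms(5-7) by (intro tendsto_integral_mult_bounded_continuous) auto
    have D: "(?D \<longlongrightarrow> f (X \<omega>)) (at_right 0)"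
      \<comment> \<open>The constant weight 1 integrates to 1 because \<open>M\<close> is a
        probability measure.\<close>
      using tendsto_integral_mult_bounded_continuous[OF assms(5,6), of Z M "\<lambda>_. 1"] assms(7)
      by (simp add: prob_space)
    have "((\<lambda>\<sigma>. ?N \<sigma> / ?D \<sigma> - Z \<omega>) \<longlongrightarrow> (\<integral>\<omega>'. Z \<omega>' \<partial>M) * f (X \<omega>) / f (X \<omega>) - Z \<omega>) (at_right 0)"
      using elim by (intro tendsto_intros N D) simp
    then have "((\<lambda>\<sigma>. ?N \<sigma> / ?D \<sigma> - Z \<omega>) \<longlongrightarrow> (\<integral>\<omega>'. Z \<omega>' \<partial>M) - Z \<omega>) (at_right 0)"
      using elim by simp
    \<comment> \<open>Since \<open>?D\<close> has a positive limit, it is positive for small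
      \<open>\<sigma>\<close>. There \<open>cond_mean\<close> is the Bayes quotient rather than its
      default value, and \<open>\<sigma> > 0\<close> cancels.\<close>
    moreover have "\<forall>\<^sub>F \<sigma> in at_right 0. ?N \<sigma> / ?D \<sigma> - Z \<omega> = scaled_error M X Z f \<sigma> \<omega>"
      using order_tendstoD(1)[OF D elim] eventually_at_right_less[of 0]
    proof eventually_elim
      case (elim \<sigma>)
      then show ?case
        by (simp add: scaled_error_def Let_def cond_mean_eq[OF ctxt assms(7)] field_simps)
    qed
    ultimately show ?case
      by (rule Lim_transform_eventually)
  qed
qed

end
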